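(* Let $m\ge 1$ and $n\ge 2$ be integers, let $M=\{1,\dots,m\}$ be a set of items and $N=\{1,\dots,n\}$ a set of agents with linear valuations given by numbers $v_{\ell i}\ge 0$ ($\ell\in M$, $i\in N$). Let $$P=\Big\{x\in\mathbb{R}_+^{mn}:\ \sum_{i=1}^n x_{\ell i}=1\ \ \forall \ell\in M\Big\},$$ and define $g:P\times(0,\infty)\to\mathbb{R}$ by $$g(x,\lambda)=\frac1\lambda\ln\Bigg(\sum_{\substack{i,j\in N,\ i\neq j\\ k\in M}}x_{kj}\prod_{\ell\in M,\ \ell\neq k}\Big(1-x_{\ell i}-x_{\ell j}+x_{\ell i}e^{-\lambda v_{\ell i}}+x_{\ell j}e^{\lambda v_{\ell i}}\Big)\Bigg).$$ Then an EFX allocation exists if and only if $\inf\{g(x,\lambda):\ \lambda>0,\ x\in P\}\le 0$.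
   Context: Linear valuations: agent $i$ values a set $S\subseteq M$ of items at $v_i(S)=\sum_{k\in S}v_{ki}$, where $v_{ki}\ge 0$ is the value agent $i$ assigns to item $k$. An EFX allocation (envy-free up to any good) is a partition $X=(X_1,\dots,X_n)$ of $M$ (pairwise disjoint, possibly empty sets with union $M$) such that $v_i(X_i)\ge v_i(X_j\setminus\{k\})$ for all $i,j\in N$ and all $k\in X_j$. The outer sum is over all ordered pairs $(i,j)$ of distinct agents and all items $k$; an empty product equals $1$. *)

theory Defs
  imports Complex_Main "HOL-Library.FuncSet" "HOL-Library.Disjoint_Sets"
    "HOL-Library.Extended_Real"
begin

text \<open>
  Items are \<open>{1..m}\<close>, agents are \<open>{1..n}\<close>; \<open>v k i\<close> is the value of item \<open>k\<close> for agent \<open>i\<close>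
  (item index first).
\<close>

definition valuation :: "(nat \<Rightarrow> nat \<Rightarrow> real) \<Rightarrow> nat \<Rightarrow> nat set \<Rightarrow> real" where
  "valuation v i S = (\<Sum>k\<in>S. v k i)"

text \<open>Bundles may be empty; values of \<open>X\<close> outside \<open>{1..n}\<close> are irrelevant.\<close>

definition is_allocation :: "nat \<Rightarrow> nat \<Rightarrow> (nat \<Rightarrow> nat set) \<Rightarrow> bool" where
  "is_allocation m n X \<longleftrightarrow> disjoint_family_on X {1..n} \<and> (\<Union>i\<in>{1..n}. X i) = {1..m}"

definition EFX_allocation ::
  "nat \<Rightarrow> nat \<Rightarrow> (nat \<Rightarrow> nat \<Rightarrow> real) \<Rightarrow> (nat \<Rightarrow> nat set) \<Rightarrow> bool" where
  "EFX_allocation m n v X \<longleftrightarrow> is_allocation m n X \<and>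
     (\<forall>i\<in>{1..n}. \<forall>j\<in>{1..n}. \<forall>k\<in>X j. valuation v i (X i) \<ge> valuation v i (X j - {k}))"

text \<open>
  The extensional function spaces make \<open>x\<close> a genuine element of the nonnegative orthant of
  dimension \<open>m * n\<close>, with coordinates \<open>x l i\<close>.
\<close>

definition fractional_allocations :: "nat \<Rightarrow> nat \<Rightarrow> (nat \<Rightarrow> nat \<Rightarrow> real) set" where
  "fractional_allocations m n =
     {x \<in> {1..m} \<rightarrow>\<^sub>E ({1..n} \<rightarrow>\<^sub>E {0..}). \<forall>l\<in>{1..m}. (\<Sum>i\<in>{1..n}. x l i) = 1}"

text \<open>
  For \<open>m \<ge> 1\<close>, \<open>n \<ge> 2\<close> and \<open>x\<close> a fractional allocation, every factor below is positive and some
  \<open>x k j\<close> is positive, so the argument of \<open>ln\<close> is positive.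
\<close>

definition g ::
  "nat \<Rightarrow> nat \<Rightarrow> (nat \<Rightarrow> nat \<Rightarrow> real) \<Rightarrow> (nat \<Rightarrow> nat \<Rightarrow> real) \<Rightarrow> real \<Rightarrow> real" where
  "g m n v x c = 1 / c * ln (\<Sum>i\<in>{1..n}. \<Sum>j\<in>{1..n} - {i}. \<Sum>k\<in>{1..m}.
     x k j * (\<Prod>l\<in>{1..m} - {k}.
       1 - x l i - x l j + x l i * exp (- c * v l i) + x l j * exp (c * v l i)))"

end

theory Submission
  imports Defs
begin

text \<open>
  Read \<open>x\<close> as a distribution on allocations that gives each item \<open>l\<close> independently to agent \<open>i\<close>
  with probability \<open>x l i\<close>. By independence, the argument of the logarithm in \<open>g\<close> is the expectation
  of the sum over \<open>i \<noteq> j\<close> and \<open>k \<in> X j\<close> of \<open>exp (c * (v\<^sub>i (X j - {k}) - v\<^sub>i (X i)))\<close>. If \<open>X\<close> is EFX,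
  the point mass at \<open>X\<close> makes this at most \<open>n * n * m\<close> for every \<open>c\<close>, and \<open>ln (n * n * m) / c\<close>
  tends to \<open>0\<close>. If there is no EFX allocation, then by finiteness every allocation has an exponent
  of at least \<open>c * \<delta>\<close> for a common \<open>\<delta> > 0\<close>, so \<open>g \<ge> \<delta>\<close> throughout.
\<close>

section \<open>Allocations as assignments of items to agents\<close>

text \<open>Encoding an allocation by the map from items to owners turns the sample space into the
  finite product \<open>{1..m} \<rightarrow>\<^sub>E {1..n}\<close>, over which products of sums
  expand.\<close>

definition items_of :: "nat \<Rightarrow> (nat \<Rightarrow> nat) \<Rightarrow> nat \<Rightarrow> nat set" where
  "items_of m \<sigma> i = {l \<in> {1..m}. \<sigma> l = i}"

definition envy :: "nat \<Rightarrow> (nat \<Rightarrow> nat \<Rightarrow> real) \<Rightarrow> (nat \<Rightarrow> nat) \<Rightarrow> nat \<Rightarrow> nat \<Rightarrow> nat \<Rightarrow> real" where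
  "envy m v \<sigma> i j k =
     valuation v i (items_of m \<sigma> j - {k}) - valuation v i (items_of m \<sigma> i)"

definition exp_envy :: "nat \<Rightarrow> nat \<Rightarrow> (nat \<Rightarrow> nat \<Rightarrow> real) \<Rightarrow> real \<Rightarrow> (nat \<Rightarrow> nat) \<Rightarrow> real" where
  "exp_envy m n v c \<sigma> = (\<Sum>i\<in>{1..n}. \<Sum>j\<in>{1..n} - {i}. \<Sum>k\<in>{1..m}.
     if \<sigma> k = j then exp (c * envy m v \<sigma> i j k) else 0)"

definition partition_sum ::
  "nat \<Rightarrow> nat \<Rightarrow> (nat \<Rightarrow> nat \<Rightarrow> real) \<Rightarrow> (nat \<Rightarrow> nat \<Rightarrow> real) \<Rightarrow> real \<Rightarrow> real" where
  "partition_sum m n v x c = (\<Sum>i\<in>{1..n}. \<Sum>j\<in>{1..n} - {i}. \<Sum>k\<in>{1..m}.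
     x k j * (\<Prod>l\<in>{1..m} - {k}.
       1 - x l i - x l j + x l i * exp (- c * v l i) + x l j * exp (c * v l i)))"

lemma g_eq: "g m n v x c = ln (partition_sum m n v x c) / c"
  by (simp add: g_def partition_sum_def)

lemma finite_items_of [simp]: "finite (items_of m \<sigma> i)"
  by (simp add: items_of_def)

lemma is_allocation_items_of:
  assumes "\<sigma> \<in> {1..m} \<rightarrow>\<^sub>E {1..n}"
  shows "is_allocation m n (items_of m \<sigma>)"
  using assms by (fastforce simp: is_allocation_def disjoint_family_on_def items_of_def PiE_iff)

text \<open>Covering gives each item an owner, and disjointness makes that owner unique. The bundles
  can agree only on \<open>{1..n}\<close>, since \<open>X\<close> is arbitrary elsewhere.\<close>

lemma allocation_eq_items_of:
  assumes "is_allocation m n X"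
  obtains \<sigma> where "\<sigma> \<in> {1..m} \<rightarrow>\<^sub>E {1..n}" "\<And>i. i \<in> {1..n} \<Longrightarrow> X i = items_of m \<sigma> i"
proof -
  have cover: "(\<Union>i\<in>{1..n}. X i) = {1..m}" and disj: "disjoint_family_on X {1..n}"
    using assms by (auto simp: is_allocation_def)
  have "\<forall>l\<in>{1..m}. \<exists>i\<in>{1..n}. l \<in> X i" using cover by blast
  then obtain s where s: "\<And>l. l \<in> {1..m} \<Longrightarrow> s l \<in> {1..n} \<and> l \<in> X (s l)" by metis
  show thesis
  proof
    show "restrict s {1..m} \<in> {1..m} \<rightarrow>\<^sub>E {1..n}" using s by auto
    fix i assume i: "i \<in> {1..n}"
    have "s l = i" if "l \<in> X i" "l \<in> {1..m}" for l
      using disj i s[OF that(2)] that(1) unfolding disjoint_family_on_def by blast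
    moreover have "X i \<subseteq> {1..m}" using cover i by blast
    ultimately show "X i = items_of m (restrict s {1..m}) i"
      using s by (auto simp: items_of_def)
  qed
qed

section \<open>The argument of the logarithm as an expectation\<close>

text \<open>The summand of \<open>exp_envy\<close> factors into functions of one item's owner each,
  which is the form that independence requires. Item \<open>k\<close> contributes the indicator that
  \<open>j\<close> receives it; any other item adds its value to the exponent if \<open>j\<close>
  owns it and subtracts it if \<open>i\<close> does.\<close>

lemma prod_eq_exp_of_envy:
  assumes "i \<noteq> j" "k \<in> {1..m}"
  shows "(\<Prod>l\<in>{1..m}. if l = k then of_bool (\<sigma> l = j)
            else exp (c * v l i * (of_bool (\<sigma> l = j) - of_bool (\<sigma> l = i)))) =
         (if \<sigma> k = j then exp (c * envy m v \<sigma> i j k) else (0::real))"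
    (is "?L = ?R")
proof -
  have "?L = of_bool (\<sigma> k = j) *
      (\<Prod>l\<in>{1..m} - {k}. exp (c * v l i * (of_bool (\<sigma> l = j) - of_bool (\<sigma> l = i))))"
    using assms by (subst prod.remove[of _ k]) auto
  also have "\<dots> = ?R"
  proof (cases "\<sigma> k = j")
    case True
    let ?M = "{1..m} - {k}"
    have vj: "(\<Sum>l\<in>?M. v l i * of_bool (\<sigma> l = j)) = valuation v i (items_of m \<sigma> j - {k})"
      unfolding valuation_def by (intro sum.mono_neutral_cong_right) (auto simp: items_of_def)
    \<comment> \<open>Omitting \<open>k\<close> loses nothing here: it belongs to \<open>j\<close>,
      hence not to \<open>i\<close>.\<close>
    have vi: "(\<Sum>l\<in>?M. v l i * of_bool (\<sigma> l = i)) = valuation v i (items_of m \<sigma> i)"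
      unfolding valuation_def
      by (intro sum.mono_neutral_cong_right) (use True assms in \<open>auto simp: items_of_def\<close>)
    have "(\<Sum>l\<in>?M. c * v l i * (of_bool (\<sigma> l = j) - of_bool (\<sigma> l = i))) =
        c * ((\<Sum>l\<in>?M. v l i * of_bool (\<sigma> l = j)) - (\<Sum>l\<in>?M. v l i * of_bool (\<sigma> l = i)))"
      unfolding sum_subtractf[symmetric] sum_distrib_left
      by (simp only: right_diff_distrib mult.assoc)
    also have "\<dots> = c * envy m v \<sigma> i j k"
      by (simp only: vj vi envy_def)
    finally have "(\<Sum>l\<in>?M. c * v l i * (of_bool (\<sigma> l = j) - of_bool (\<sigma> l = i))) =
        c * envy m v \<sigma> i j k" .
    then show ?thesis using True by (simp flip: exp_sum)
  qed simp
  finally show ?thesis .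
qed

text \<open>Each factor in \<open>partition_sum\<close> is the mean, over the random owner of one
  item, of the corresponding factor in \<open>prod_eq_exp_of_envy\<close>. Independence is the
  expansion of a product of sums over all assignments.\<close>

lemma partition_sum_eq_expectation:
  assumes x: "\<And>l. l \<in> {1..m} \<Longrightarrow> (\<Sum>i\<in>{1..n}. x l i) = 1"
  shows "partition_sum m n v x c =
    (\<Sum>\<sigma>\<in>{1..m} \<rightarrow>\<^sub>E {1..n}. (\<Prod>l\<in>{1..m}. x l (\<sigma> l)) * exp_envy m n v c \<sigma>)"
proof -
  let ?S = "{1..m} \<rightarrow>\<^sub>E {1..n}"
  define w :: "nat \<Rightarrow> nat \<Rightarrow> nat \<Rightarrow> nat \<Rightarrow> nat \<Rightarrow> real" where
    "w i j k l a = (if l = k then of_bool (a = j)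
       else exp (c * v l i * (of_bool (a = j) - of_bool (a = i))))" for i j k l a
  have factor: "x k j * (\<Prod>l\<in>{1..m} - {k}.
       1 - x l i - x l j + x l i * exp (- c * v l i) + x l j * exp (c * v l i)) =
     (\<Sum>\<sigma>\<in>?S. (\<Prod>l\<in>{1..m}. x l (\<sigma> l)) *
        (if \<sigma> k = j then exp (c * envy m v \<sigma> i j k) else 0))" (is "?L = ?R")
    if ij: "i \<in> {1..n}" "j \<in> {1..n}" "i \<noteq> j" and k: "k \<in> {1..m}" for i j k
  proof -
    have "(\<Sum>a\<in>{1..n}. x k a * w i j k k a) = (\<Sum>a\<in>{1..n}. if a = j then x k a else 0)"
      by (intro sum.cong) (auto simp: w_def)
    then have wk: "(\<Sum>a\<in>{1..n}. x k a * w i j k k a) = x k j"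
      using ij by simp
    have wl: "(\<Sum>a\<in>{1..n}. x l a * w i j k l a) =
        1 - x l i - x l j + x l i * exp (- c * v l i) + x l j * exp (c * v l i)"
      if l: "l \<in> {1..m} - {k}" for l
    proof -
      let ?A = "{1..n} - {i} - {j}"
      have split: "sum f {1..n} = f i + (f j + sum f ?A)" for f :: "nat \<Rightarrow> real"
        using ij by (subst sum.remove[of _ i]; simp; subst sum.remove[of _ j]; simp)
      \<comment> \<open>An owner other than \<open>i\<close> and \<open>j\<close> gives the factor
        \<open>exp 0\<close>, so these agents together contribute their mass
        \<open>1 - x l i - x l j\<close>.\<close>
      have "(\<Sum>a\<in>?A. x l a * w i j k l a) = sum (x l) ?A"
        using l by (intro sum.cong) (auto simp: w_def)
      moreover have "sum (x l) {1..n} = 1" using x l by blast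
      ultimately show ?thesis
        unfolding split[of "\<lambda>a. x l a * w i j k l a"] using split[of "x l"] l ij
        by (simp add: w_def)
    qed
    have "?L = (\<Prod>l\<in>{1..m}. \<Sum>a\<in>{1..n}. x l a * w i j k l a)"
      using k wk wl by (subst prod.remove[of "{1..m}" k]) auto
    also have "\<dots> = (\<Sum>\<sigma>\<in>?S. \<Prod>l\<in>{1..m}. x l (\<sigma> l) * w i j k l (\<sigma> l))"
      by (rule prod_sum_PiE) auto
    also have "\<dots> = ?R"
      unfolding prod.distrib w_def prod_eq_exp_of_envy[OF ij(3) k] ..
    finally show ?thesis .
  qed
  have "partition_sum m n v x c = (\<Sum>i\<in>{1..n}. \<Sum>j\<in>{1..n} - {i}. \<Sum>k\<in>{1..m}.
     \<Sum>\<sigma>\<in>?S. (\<Prod>l\<in>{1..m}. x l (\<sigma> l)) *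
        (if \<sigma> k = j then exp (c * envy m v \<sigma> i j k) else 0))"
    unfolding partition_sum_def by (intro sum.cong refl factor) auto
  also have "\<dots> = (\<Sum>\<sigma>\<in>?S. \<Sum>i\<in>{1..n}. \<Sum>j\<in>{1..n} - {i}. \<Sum>k\<in>{1..m}.
     (\<Prod>l\<in>{1..m}. x l (\<sigma> l)) * (if \<sigma> k = j then exp (c * envy m v \<sigma> i j k) else 0))"
    by (simp only: sum.swap[of _ ?S])
  also have "\<dots> = (\<Sum>\<sigma>\<in>?S. (\<Prod>l\<in>{1..m}. x l (\<sigma> l)) * exp_envy m n v c \<sigma>)"
    by (simp only: exp_envy_def sum_distrib_left)
  finally show ?thesis .
qed

lemma partition_sum_point_mass:
  assumes \<sigma>: "\<sigma> \<in> {1..m} \<rightarrow>\<^sub>E {1..n}"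
  obtains x where "x \<in> fractional_allocations m n"
    "\<And>c. partition_sum m n v x c = exp_envy m n v c \<sigma>"
proof
  let ?S = "{1..m} \<rightarrow>\<^sub>E {1..n}"
  define x :: "nat \<Rightarrow> nat \<Rightarrow> real" where
    \<comment> \<open>Both abstractions are restricted so that \<open>x\<close> lies in the
      extensional function spaces.\<close>
    "x = (\<lambda>l\<in>{1..m}. \<lambda>i\<in>{1..n}. of_bool (\<sigma> l = i))"
  have \<sigma>n: "\<sigma> l \<in> {1..n}" if "l \<in> {1..m}" for l using \<sigma> that by blast
  have row: "(\<Sum>i\<in>{1..n}. x l i) = 1" if "l \<in> {1..m}" for l
    using \<sigma>n[OF that] that by (simp add: x_def of_bool_def)
  show "x \<in> fractional_allocations m n"
    using row by (auto simp: fractional_allocations_def x_def)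
  fix c
  have mass: "(\<Prod>l\<in>{1..m}. x l (\<tau> l)) = of_bool (\<tau> = \<sigma>)" if \<tau>: "\<tau> \<in> ?S" for \<tau>
  proof (cases "\<tau> = \<sigma>")
    case True
    then show ?thesis using \<sigma>n by (auto simp: x_def intro!: prod.neutral)
  next
    case False
    then obtain l where l: "l \<in> {1..m}" "\<tau> l \<noteq> \<sigma> l"
      using PiE_ext[OF \<tau> \<sigma>] by blast
    moreover have "\<tau> l \<in> {1..n}" using \<tau> l by blast
    ultimately have "x l (\<tau> l) = 0" by (simp add: x_def)
    with l False show ?thesis by (auto intro: prod_zero)
  qed
  have "partition_sum m n v x c =
      (\<Sum>\<tau>\<in>?S. (\<Prod>l\<in>{1..m}. x l (\<tau> l)) * exp_envy m n v c \<tau>)"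
    by (rule partition_sum_eq_expectation) (rule row)
  also have "\<dots> = (\<Sum>\<tau>\<in>?S. if \<tau> = \<sigma> then exp_envy m n v c \<tau> else 0)"
    by (intro sum.cong refl) (simp only: mass, simp)
  also have "\<dots> = exp_envy m n v c \<sigma>"
    using \<sigma> by (subst sum.delta) (auto simp: finite_PiE)
  finally show "partition_sum m n v x c = exp_envy m n v c \<sigma>" .
qed

section \<open>Bounds for a single assignment\<close>

lemma exp_envy_nonneg: "exp_envy m n v c \<sigma> \<ge> 0"
  unfolding exp_envy_def by (intro sum_nonneg) auto

lemma exp_envy_le:
  assumes efx: "EFX_allocation m n v (items_of m \<sigma>)" and "c > 0"
  shows "exp_envy m n v c \<sigma> \<le> real n * real n * real m"
proof -
  have "exp_envy m n v c \<sigma> \<le> (\<Sum>i\<in>{1..n}. \<Sum>j\<in>{1..n} - {i}. \<Sum>k\<in>{1..m}. 1)"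
    unfolding exp_envy_def
  proof (intro sum_mono)
    fix i j k assume ijk: "i \<in> {1..n}" "j \<in> {1..n} - {i}" "k \<in> {1..m}"
    have "envy m v \<sigma> i j k \<le> 0" if "\<sigma> k = j"
      using efx ijk that by (auto simp: EFX_allocation_def envy_def items_of_def)
    then show "(if \<sigma> k = j then exp (c * envy m v \<sigma> i j k) else 0) \<le> 1"
      using \<open>c > 0\<close> by (simp add: mult_nonneg_nonpos)
  qed
  \<comment> \<open>Adding the diagonal \<open>j = i\<close> gives a count free of truncated
    subtraction.\<close>
  also have "\<dots> \<le> (\<Sum>i\<in>{1..n}. \<Sum>j\<in>{1..n}. \<Sum>k\<in>{1..m}. 1)"
    by (intro sum_mono sum_mono2) auto
  finally show ?thesis by simp
qed

lemma exp_le_exp_envy: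
  assumes "i \<in> {1..n}" "j \<in> {1..n}" "i \<noteq> j" "k \<in> items_of m \<sigma> j"
    and "c > 0" "\<delta> \<le> envy m v \<sigma> i j k"
  shows "exp (c * \<delta>) \<le> exp_envy m n v c \<sigma>"
proof -
  let ?t = "\<lambda>i j k. if \<sigma> k = j then exp (c * envy m v \<sigma> i j k) else 0"
  have "exp (c * \<delta>) \<le> ?t i j k" using assms by (simp add: items_of_def)
  also have "\<dots> \<le> (\<Sum>k\<in>{1..m}. ?t i j k)"
    using assms by (intro member_le_sum) (auto simp: items_of_def)
  also have "\<dots> \<le> (\<Sum>j\<in>{1..n} - {i}. \<Sum>k\<in>{1..m}. ?t i j k)"
    by (rule member_le_sum[where f = "\<lambda>j. \<Sum>k\<in>{1..m}. ?t i j k"])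
      (use assms in \<open>simp_all add: sum_nonneg\<close>)
  also have "\<dots> \<le> exp_envy m n v c \<sigma>"
    unfolding exp_envy_def
    by (rule member_le_sum[where f = "\<lambda>i. \<Sum>j\<in>{1..n} - {i}. \<Sum>k\<in>{1..m}. ?t i j k"])
      (use assms in \<open>simp_all add: sum_nonneg\<close>)
  finally show ?thesis .
qed

text \<open>The EFX condition includes \<open>j = i\<close>, while \<open>exp_envy\<close> sums over
  distinct agents only. A violation is never diagonal, because with nonnegative values a bundle
  loses no worth to its own subsets.\<close>

lemma not_EFX_imp_envy_pos:
  assumes "\<sigma> \<in> {1..m} \<rightarrow>\<^sub>E {1..n}" "\<not> EFX_allocation m n v (items_of m \<sigma>)"
    and nonneg: "\<And>l i. l \<in> {1..m} \<Longrightarrow> i \<in> {1..n} \<Longrightarrow> v l i \<ge> 0"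
  obtains i j k where "i \<in> {1..n}" "j \<in> {1..n}" "i \<noteq> j" "k \<in> items_of m \<sigma> j"
    "envy m v \<sigma> i j k > 0"
proof -
  obtain i j k where ijk: "i \<in> {1..n}" "j \<in> {1..n}" "k \<in> items_of m \<sigma> j"
    and pos: "envy m v \<sigma> i j k > 0"
    using assms(2) is_allocation_items_of[OF assms(1)]
    by (auto simp: EFX_allocation_def envy_def not_le)
  have "envy m v \<sigma> i i k \<le> 0"
    unfolding envy_def valuation_def
    using sum_mono2[of "items_of m \<sigma> i" "items_of m \<sigma> i - {k}" "\<lambda>k. v k i"] nonneg ijk
    by (auto simp: items_of_def)
  with pos have "i \<noteq> j" by auto
  with that ijk pos show thesis by blast
qed

section \<open>Bounds for \<open>g\<close>\<close>

text \<open>The bound \<delta> is the least violation chosen over the finitely many assignments. A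
  weighted average of values that are at least \<open>exp (c * \<delta>)\<close> is again at least
  that.\<close>

lemma no_EFX_imp_g_bounded_below:
  assumes no: "\<And>X. \<not> EFX_allocation m n v X" and "n \<ge> 1"
    and nonneg: "\<And>l i. l \<in> {1..m} \<Longrightarrow> i \<in> {1..n} \<Longrightarrow> v l i \<ge> 0"
  obtains \<delta> where "\<delta> > 0"
    "\<And>x c. x \<in> fractional_allocations m n \<Longrightarrow> c > 0 \<Longrightarrow> \<delta> \<le> g m n v x c"
proof -
  let ?S = "{1..m} \<rightarrow>\<^sub>E {1..n}"
  have fin: "finite ?S" by (simp add: finite_PiE)
  have ne: "?S \<noteq> {}" using \<open>n \<ge> 1\<close> by (simp add: PiE_eq_empty_iff)
  \<comment> \<open>Allowing every \<delta> below \<open>d\<close> lets one common minimum replace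
    the separate bounds.\<close>
  have "\<forall>\<sigma>\<in>?S. \<exists>d>0. \<forall>c>0. \<forall>\<delta>\<le>d. exp (c * \<delta>) \<le> exp_envy m n v c \<sigma>"
  proof
    fix \<sigma> assume \<sigma>: "\<sigma> \<in> ?S"
    from not_EFX_imp_envy_pos[of \<sigma> m n v, OF \<sigma> no nonneg]
    obtain i j k where "i \<in> {1..n}" "j \<in> {1..n}" "i \<noteq> j" "k \<in> items_of m \<sigma> j"
      and "envy m v \<sigma> i j k > 0" by blast
    then show "\<exists>d>0. \<forall>c>0. \<forall>\<delta>\<le>d. exp (c * \<delta>) \<le> exp_envy m n v c \<sigma>"
      by (intro exI[of _ "envy m v \<sigma> i j k"]) (auto intro: exp_le_exp_envy)
  qed
  then obtain d where d: "\<And>\<sigma>. \<sigma> \<in> ?S \<Longrightarrow> d \<sigma> > 0"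
    "\<And>\<sigma> c \<delta>. \<sigma> \<in> ?S \<Longrightarrow> c > 0 \<Longrightarrow> \<delta> \<le> d \<sigma> \<Longrightarrow> exp (c * \<delta>) \<le> exp_envy m n v c \<sigma>"
    by (metis (no_types, lifting))
  define \<delta> where "\<delta> = Min (d ` ?S)"
  show thesis
  proof
    show "\<delta> > 0" using fin ne d by (simp add: \<delta>_def)
    fix x and c :: real assume x: "x \<in> fractional_allocations m n" and c: "c > 0"
    have row: "(\<Sum>i\<in>{1..n}. x l i) = 1" if "l \<in> {1..m}" for l
      using x that by (auto simp: fractional_allocations_def)
    have x0: "x l i \<ge> 0" if "l \<in> {1..m}" "i \<in> {1..n}" for l i
    proof -
      have "x l \<in> {1..n} \<rightarrow>\<^sub>E {0..}" using x that by (auto simp: fractional_allocations_def)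
      then show ?thesis using that by (auto simp: PiE_iff)
    qed
    let ?p = "\<lambda>\<sigma>. \<Prod>l\<in>{1..m}. x l (\<sigma> l)"
    have total: "sum ?p ?S = 1"
    proof -
      have "sum ?p ?S = (\<Prod>l\<in>{1..m}. \<Sum>i\<in>{1..n}. x l i)"
        by (rule prod_sum_PiE[symmetric]) auto
      then show ?thesis using row by simp
    qed
    have "exp (c * \<delta>) = (\<Sum>\<sigma>\<in>?S. ?p \<sigma> * exp (c * \<delta>))"
      using total by (simp flip: sum_distrib_right)
    also have "\<dots> \<le> (\<Sum>\<sigma>\<in>?S. ?p \<sigma> * exp_envy m n v c \<sigma>)"
    proof (intro sum_mono mult_left_mono)
      fix \<sigma> assume \<sigma>: "\<sigma> \<in> ?S"
      show "exp (c * \<delta>) \<le> exp_envy m n v c \<sigma>"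
        using fin \<sigma> c by (intro d(2)) (auto simp: \<delta>_def)
      show "0 \<le> ?p \<sigma>" using \<sigma> x0 by (intro prod_nonneg) (auto simp: PiE_iff)
    qed
    also have "\<dots> = partition_sum m n v x c"
      by (rule partition_sum_eq_expectation[symmetric]) (rule row)
    \<comment> \<open>The exponential lower bound also supplies the positivity that
      \<open>ln_ge_iff\<close> asks for.\<close>
    finally have "c * \<delta> \<le> ln (partition_sum m n v x c)"
      by (subst ln_ge_iff) (use less_le_trans[OF exp_gt_zero] in auto)
    then show "\<delta> \<le> g m n v x c"
      using c by (simp add: g_eq pos_le_divide_eq mult.commute)
  qed
qed

lemma EFX_imp_g_arbitrarily_small:
  assumes "EFX_allocation m n v X" and "\<epsilon> > 0"
  obtains x c where "x \<in> fractional_allocations m n" "c > 0" "g m n v x c \<le> \<epsilon>"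
proof -
  obtain \<sigma> where \<sigma>: "\<sigma> \<in> {1..m} \<rightarrow>\<^sub>E {1..n}" and X: "\<And>i. i \<in> {1..n} \<Longrightarrow> X i = items_of m \<sigma> i"
    using assms(1) allocation_eq_items_of unfolding EFX_allocation_def by metis
  have efx: "EFX_allocation m n v (items_of m \<sigma>)"
    using assms(1) X is_allocation_items_of[OF \<sigma>] by (auto simp: EFX_allocation_def)
  obtain x where x: "x \<in> fractional_allocations m n"
    and eq: "\<And>c. partition_sum m n v x c = exp_envy m n v c \<sigma>"
    using partition_sum_point_mass[OF \<sigma>] by metis
  \<comment> \<open>The added 1 keeps \<open>ln C\<close> nonnegative even if \<open>m\<close> or
    \<open>n\<close> is 0.\<close>
  define C where "C = real n * real n * real m + 1"
  have C: "C \<ge> 1" by (simp add: C_def)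
  \<comment> \<open>This makes \<open>ln C / c\<close> at most \<epsilon>; the 1 in the numerator
    keeps \<open>c\<close> positive when \<open>ln C\<close> is 0.\<close>
  define c where "c = (ln C + 1) / \<epsilon>"
  have c: "c > 0" using C \<open>\<epsilon> > 0\<close> by (simp add: c_def add_nonneg_pos)
  \<comment> \<open>An empty sum, as for \<open>n = 1\<close>, is covered by the convention
    \<open>ln 0 = 0\<close>.\<close>
  have "ln (exp_envy m n v c \<sigma>) \<le> ln C"
    using exp_envy_le[OF efx c] exp_envy_nonneg[of m n v c \<sigma>] C
    by (cases "exp_envy m n v c \<sigma> = 0") (auto simp: C_def)
  also have "\<dots> \<le> \<epsilon> * c" using \<open>\<epsilon> > 0\<close> by (simp add: c_def)
  finally have "g m n v x c \<le> \<epsilon>" using c by (simp add: g_eq eq pos_divide_le_eq)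
  with x c that show thesis by blast
qed

text \<open>Taking the infimum in \<open>ereal\<close> gives it its usual meaning without first
  showing that the values of \<open>g\<close> are bounded below.\<close>

theorem lemma2:
  fixes m n :: nat and v :: "nat \<Rightarrow> nat \<Rightarrow> real"
  assumes "m \<ge> 1" and "n \<ge> 2"
    and "\<And>l i. l \<in> {1..m} \<Longrightarrow> i \<in> {1..n} \<Longrightarrow> v l i \<ge> 0"
  shows "(\<exists>X. EFX_allocation m n v X) \<longleftrightarrow>
    Inf {ereal (g m n v x c) | x c. c > 0 \<and> x \<in> fractional_allocations m n} \<le> 0"
    (is "_ \<longleftrightarrow> Inf ?G \<le> 0")
proof
  assume "\<exists>X. EFX_allocation m n v X"
  then obtain X where X: "EFX_allocation m n v X" ..
  have "Inf ?G \<le> ereal \<epsilon>" if \<epsilon>: "\<epsilon> > 0" for \<epsilon>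
  proof -
    obtain x c where "x \<in> fractional_allocations m n" "c > 0" "g m n v x c \<le> \<epsilon>"
      using EFX_imp_g_arbitrarily_small[OF X \<epsilon>] by blast
    then show ?thesis by (intro Inf_lower2[of "ereal (g m n v x c)"]) auto
  qed
  then show "Inf ?G \<le> 0"
    by - (rule ereal_le_epsilon2, simp)
next
  assume le: "Inf ?G \<le> 0"
  show "\<exists>X. EFX_allocation m n v X"
  proof (rule ccontr)
    assume "\<not> ?thesis"
    then obtain \<delta> where "\<delta> > 0"
      and bound: "\<And>x c. x \<in> fractional_allocations m n \<Longrightarrow> c > 0 \<Longrightarrow> \<delta> \<le> g m n v x c"
      using no_EFX_imp_g_bounded_below[of m n v] assms(2,3) by auto
    have "ereal \<delta> \<le> Inf ?G" using bound by (intro Inf_greatest) auto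
    with le have "ereal \<delta> \<le> 0" by (rule order_trans[rotated])
    with \<open>\<delta> > 0\<close> show False by simp
  qed
qed

end
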